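(* Let $G=(V,E,\omega)\in\mathbb{G}$ and let $S\in st(G)$ be a structural set of $G$. Then $\sigma(G)$ and $\sigma(\mathcal{R}_S(G))$ differ at most by $\mathcal{N}(G;S)$, i.e. $\sigma(G)\setminus\mathcal{N}(G;S)=\sigma(\mathcal{R}_S(G))\setminus\mathcal{N}(G;S)$.
   Context: $\mathbb{W}$ is the field of complex rational functions $p/q$ in one variable $\lambda$, with $p,q\in\mathbb{C}[\lambda]$, $q\neq 0$, written in lowest terms. $\mathbb{G}$ is the class of finite weighted digraphs $G=(V,E,\omega)$ without parallel edges but possibly with loops, with weight function $\omega:E\to\mathbb{W}$ and the convention $\omega(e)=0$ iff $e\notin E$. With $V=\{v_1,\dots,v_n\}$, write $e_{ij}=(v_i,v_j)$; the weighted adjacency matrix is $M(G)_{ij}=\omega(e_{ij})$. The spectrum $\sigma(G)$ is the list (multiset) of solutions $\lambda\in\mathbb{C}$, counted with multiplicity, of $\det(M(G)-\lambda I)=0$. For $N\subseteq\mathbb{C}$, $\sigma(G)\setminus N$ is the sublist of elements of $\sigma(G)$ not in $N$ (with their multiplicities); $\sigma(G)$ and $\sigma(H)$ "differ at most by $N$" if $\sigma(G)\setminus N=\sigma(H)\setminus N$. A path is a sequence $u_1,\dots,u_k$ of distinct vertices with $(u_t,u_{t+1})\in E$ for all $t$; a cycle is such a sequence whose vertices are distinct except $u_1=u_k$ (a loop $u_1,u_1$ is a cycle). The interior vertices are $u_2,\dots,u_{k-1}$. $\ell(G)$ is $G$ with all loops removed. A structural set of $G$ is a nonempty $S\subseteq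 V$ such that $\bar S=V\setminus S$ induces no cycle in $\ell(G)$ and $\omega(e_{ii})\neq\lambda$ (as elements of $\mathbb{W}$) for every $v_i\in\bar S$; $st(G)$ is the set of structural sets. For $v_i,v_j\in S$, $\mathcal{B}_{ij}(G;S)$ is the set of paths or cycles from $v_i$ to $v_j$ having no interior vertex in $S$ (branches). For a branch $\beta=u_1,\dots,u_k$ its branch product is $\mathcal{P}_\omega(\beta)=\omega(u_1,u_2)\prod_{t=2}^{k-1}\frac{\omega(u_t,u_{t+1})}{\lambda-\omega(u_t,u_t)}$ if $k>2$ and $\mathcal{P}_\omega(\beta)=\omega(u_1,u_2)$ if $k=2$. The isospectral reduction $\mathcal{R}_S(G)=(S,\mathcal{E},\mu)$ is the weighted digraph on vertex set $S$ with an edge $(v_i,v_j)$ iff $\mathcal{B}_{ij}(G;S)\neq\emptyset$, of weight $\mu(v_i,v_j)=\sum_{\beta\in\mathcal{B}_{ij}(G;S)}\mathcal{P}_\omega(\beta)$. $\mathcal{N}(G;S)=\bigcup_{v_i\in\bar S}\{\lambda\in\mathbb{C}:\ \lambda=\omega(e_{ii})(\lambda)\ \text{or}\ \omega(e_{ii})\ \text{is undefined at}\ \lambda\}$. *)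

theory Defs
  imports
    "Graph_Theory.Graph_Theory"
    "Jordan_Normal_Form.Determinant"
    "HOL-Computational_Algebra.Normalized_Fraction"
    "HOL-Computational_Algebra.Field_as_Ring"
    "HOL-Library.Extended_Nat"
begin

type_synonym ratfun = "complex poly fract"

abbreviation ratvar :: ratfun where
  "ratvar \<equiv> to_fract [:0, 1:]"

text \<open>
  \<^const>\<open>quot_of_fract\<close> yields the representation in lowest terms (with monic denominator),
  so a rational function is defined exactly off the zeros of that denominator.
\<close>

definition ratfun_defined_at :: "ratfun \<Rightarrow> complex \<Rightarrow> bool" where
  "ratfun_defined_at r z \<longleftrightarrow> poly (snd (quot_of_fract r)) z \<noteq> 0"

definition ratfun_eval :: "ratfun \<Rightarrow> complex \<Rightarrow> complex" where
  "ratfun_eval r z = poly (fst (quot_of_fract r)) z / poly (snd (quot_of_fract r)) z"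

record 'a wdigraph =
  graph :: "'a pair_pre_digraph"
  weight :: "'a \<times> 'a \<Rightarrow> ratfun"

abbreviation vertices :: "'a wdigraph \<Rightarrow> 'a set" where
  "vertices G \<equiv> pverts (graph G)"

abbreviation edges :: "'a wdigraph \<Rightarrow> ('a \<times> 'a) set" where
  "edges G \<equiv> parcs (graph G)"

locale weighted_digraph = pair_fin_digraph "graph G" for G :: "'a wdigraph" +
  assumes weight_eq_0_iff: "weight G e = 0 \<longleftrightarrow> e \<notin> edges G"


text \<open>
  The adjacency matrix depends on an enumeration of the vertices; its determinants do not
  (lemma \<open>det_adj_mat_enum_indep\<close> below).
\<close>

definition adj_mat :: "'a wdigraph \<Rightarrow> 'a list \<Rightarrow> ratfun mat" where
  "adj_mat G vs = mat (length vs) (length vs) (\<lambda>(i, j). weight G (vs ! i, vs ! j))"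

definition char_det_enum :: "'a wdigraph \<Rightarrow> 'a list \<Rightarrow> ratfun" where
  "char_det_enum G vs = det (adj_mat G vs - ratvar \<cdot>\<^sub>m 1\<^sub>m (length vs))"

definition char_det :: "'a wdigraph \<Rightarrow> ratfun" where
  "char_det G = char_det_enum G (SOME vs. distinct vs \<and> set vs = vertices G)"

text \<open>
  A list of complex numbers with multiplicities is given by its multiplicity function. The
  multiplicity of a solution of \<open>det (M(G) - \<lambda> I) = 0\<close> is its order as a zero of the numerator
  in lowest terms. If the determinant vanishes identically (which is possible, as a loop may have
  weight \<open>\<lambda>\<close>), every complex number is a solution, and its multiplicity is infinite.
\<close>

definition spectrum :: "'a wdigraph \<Rightarrow> complex \<Rightarrow> enat" where
  "spectrum G z =
     (if char_det G = 0 then \<infinity> else enat (order z (fst (quot_of_fract (char_det G)))))"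

definition list_diff :: "(complex \<Rightarrow> enat) \<Rightarrow> complex set \<Rightarrow> complex \<Rightarrow> enat" where
  "list_diff \<sigma> N = (\<lambda>z. if z \<in> N then 0 else \<sigma> z)"

definition differ_at_most :: "complex set \<Rightarrow> (complex \<Rightarrow> enat) \<Rightarrow> (complex \<Rightarrow> enat) \<Rightarrow> bool" where
  "differ_at_most N \<sigma> \<tau> \<longleftrightarrow> list_diff \<sigma> N = list_diff \<tau> N"


definition remove_loops :: "'a pair_pre_digraph \<Rightarrow> 'a pair_pre_digraph" where
  "remove_loops H = H\<lparr>parcs := {e \<in> parcs H. fst e \<noteq> snd e}\<rparr>"

definition structural_sets :: "'a wdigraph \<Rightarrow> 'a set set" where
  "structural_sets G =
     {S. S \<noteq> {} \<and> S \<subseteq> vertices G \<and>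
         \<not> (\<exists>p. pre_digraph.cycle
                  (induce_subgraph (with_proj (remove_loops (graph G))) (vertices G - S)) p) \<and>
         (\<forall>v \<in> vertices G - S. weight G (v, v) \<noteq> ratvar)}"

text \<open>
  Paths and cycles \<open>u\<^sub>1, \<dots>, u\<^sub>k\<close> are represented by their edge lists
  \<open>[(u\<^sub>1, u\<^sub>2), \<dots>, (u\<^sub>k\<^sub>-\<^sub>1, u\<^sub>k)]\<close>, where \<open>k \<ge> 2\<close>: the branch product
  of a one-vertex path is not defined, so it is not a branch. The interior vertices
  \<open>u\<^sub>2, \<dots>, u\<^sub>k\<^sub>-\<^sub>1\<close> are the first components of all edges but the first.
\<close>

definition branches :: "'a wdigraph \<Rightarrow> 'a set \<Rightarrow> 'a \<Rightarrow> 'a \<Rightarrow> ('a \<times> 'a) list set" where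
  "branches G S i j =
     {p. p \<noteq> [] \<and>
         (pre_digraph.apath (with_proj (graph G)) i p j \<or>
          pre_digraph.awalk (with_proj (graph G)) i p j \<and>
            pre_digraph.cycle (with_proj (graph G)) p) \<and>
         set (pre_digraph.inner_verts (with_proj (graph G)) p) \<inter> S = {}}"

definition branch_product :: "'a wdigraph \<Rightarrow> ('a \<times> 'a) list \<Rightarrow> ratfun" where
  "branch_product G p =
     weight G (hd p) * (\<Prod>e\<leftarrow>tl p. weight G e / (ratvar - weight G (fst e, fst e)))"

text \<open>
  The branch products may cancel, so that an edge of the reduction has weight \<open>0\<close>. The edge is
  then kept, and the reduction need not be a \<^const>\<open>weighted_digraph\<close>.
\<close>

definition isospectral_reduction :: "'a wdigraph \<Rightarrow> 'a set \<Rightarrow> 'a wdigraph" where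
  "isospectral_reduction G S =
     (let E = {(i, j). i \<in> S \<and> j \<in> S \<and> branches G S i j \<noteq> {}} in
      \<lparr>graph = \<lparr>pverts = S, parcs = E\<rparr>,
       weight = (\<lambda>(i, j). if (i, j) \<in> E then \<Sum>p\<in>branches G S i j. branch_product G p else 0)\<rparr>)"

definition exceptional_set :: "'a wdigraph \<Rightarrow> 'a set \<Rightarrow> complex set" where
  "exceptional_set G S =
     (\<Union>v \<in> vertices G - S.
        {z. (ratfun_defined_at (weight G (v, v)) z \<and> z = ratfun_eval (weight G (v, v)) z) \<or>
            \<not> ratfun_defined_at (weight G (v, v)) z})"


lemma (in weighted_digraph) finite_branches: "finite (branches G S i j)"
proof (rule finite_subset)
  show "branches G S i j \<subseteq> {p. set p \<subseteq> edges G \<and> length p \<le> card (vertices G)}"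
  proof
    fix p assume p: "p \<in> branches G S i j"
    then obtain u w where
      w: "awalk u p w" and d: "distinct (tl (pawalk_verts u p))"
      by (auto simp: branches_def apath_def cycle_def distinct_tl)
    have "set (pawalk_verts u p) \<subseteq> vertices G"
      using w awalk_verts_in_verts[of u p] by (auto simp: awalk_def)
    then have "set (tl (pawalk_verts u p)) \<subseteq> vertices G"
      by (cases "pawalk_verts u p") auto
    then have "length (tl (pawalk_verts u p)) \<le> card (vertices G)"
      using d pair_finite_verts by (metis card_mono distinct_card)
    moreover have "length (pawalk_verts u p) = Suc (length p)"
      by (induct p arbitrary: u) auto
    ultimately show "p \<in> {p. set p \<subseteq> edges G \<and> length p \<le> card (vertices G)}"
      using w by (auto simp: awalk_def)
  qed
  show "finite {p. set p \<subseteq> edges G \<and> length p \<le> card (vertices G)}"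
    using finite_lists_length_le[OF pair_finite_arcs] .
qed

lemma det_mat_enum_indep:
  fixes f :: "'a \<Rightarrow> 'a \<Rightarrow> 'b :: comm_ring_1"
  assumes "distinct vs" "distinct ws" "set vs = set ws"
  shows "det (mat (length vs) (length vs) (\<lambda>(i, j). f (vs ! i) (vs ! j))) =
         det (mat (length ws) (length ws) (\<lambda>(i, j). f (ws ! i) (ws ! j)))"
proof -
  let ?n = "length vs"
  have "mset ws = mset vs"
    using assms by (simp add: set_eq_iff_mset_eq_distinct)
  then obtain \<pi> where \<pi>: "\<pi> permutes {..<?n}" and ws: "ws = permute_list \<pi> vs"
    by (metis mset_eq_permutation)
  have \<pi>': "\<pi> permutes {0..<?n}" using \<pi> by (simp add: atLeast0LessThan)
  have lt: "\<pi> i < ?n" if "i < ?n" for i using permutes_in_image[OF \<pi>] that by auto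
  have len: "length ws = ?n" by (simp add: ws)
  have nth: "ws ! i = vs ! \<pi> i" if "i < ?n" for i
    using that \<pi> by (simp add: ws permute_list_nth)
  define A where "A = mat ?n ?n (\<lambda>(i, j). f (vs ! i) (vs ! j))"
  define B where "B = mat ?n ?n (\<lambda>(i, j). f (vs ! \<pi> i) (vs ! j))"
  define C where "C = mat ?n ?n (\<lambda>(i, j). f (ws ! i) (ws ! j))"
  have "B = mat ?n ?n (\<lambda>(i, j). A $$ (\<pi> i, j))"
    by (rule eq_matI) (auto simp: A_def B_def lt)
  then have 1: "det B = signof \<pi> * det A"
    using det_permute_rows[of A ?n \<pi>] \<pi>' by (simp add: A_def)
  have "transpose_mat C = mat ?n ?n (\<lambda>(i, j). transpose_mat B $$ (\<pi> i, j))"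
    by (rule eq_matI) (auto simp: B_def C_def lt nth)
  then have "det (transpose_mat C) = signof \<pi> * det (transpose_mat B)"
    using det_permute_rows[of "transpose_mat B" ?n \<pi>] \<pi>' by (simp add: B_def)
  then have 2: "det C = signof \<pi> * det B"
    using det_transpose[of C ?n] det_transpose[of B ?n] by (simp add: B_def C_def)
  show ?thesis
    using 1 2 unfolding A_def[symmetric] len C_def[symmetric]
    by (simp add: sign_def)
qed

lemma det_adj_mat_enum_indep:
  assumes "distinct vs" "distinct ws" "set vs = set ws"
  shows "char_det_enum G vs = char_det_enum G ws"
proof -
  have *: "adj_mat G us - ratvar \<cdot>\<^sub>m 1\<^sub>m (length us) =
      mat (length us) (length us)
        (\<lambda>(i, j). (\<lambda>u v. weight G (u, v) - (if u = v then ratvar else 0)) (us ! i) (us ! j))"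
    if "distinct us" for us :: "'a list"
    using that by (intro eq_matI) (auto simp: adj_mat_def nth_eq_iff_index_eq)
  show ?thesis
    unfolding char_det_enum_def *[OF assms(1)] *[OF assms(2)]
    using assms by (rule det_mat_enum_indep)
qed

lemma char_det_eq:
  assumes "distinct vs" "set vs = vertices G"
  shows "char_det G = char_det_enum G vs"
proof -
  let ?P = "\<lambda>vs. distinct vs \<and> set vs = vertices G"
  have "?P (SOME vs. ?P vs)" using someI[of ?P vs] assms by blast
  then show ?thesis
    unfolding char_det_def using assms by (intro det_adj_mat_enum_indep) auto
qed

end

theory Submission
  imports Defs
begin

text \<open>
  For \<open>b\<close> outside \<open>S\<close> let \<open>F(b, j)\<close> be the sum, over the paths from \<open>b\<close> to \<open>j \<in> S\<close> that meet
  \<open>S\<close> only at their end, of the products of \<open>\<omega>(e) / (\<lambda> - \<omega>(v, v))\<close> over the edges \<open>e\<close> of the path,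
  where \<open>v\<close> is the tail of \<open>e\<close>. Splitting off the first edge shows that, in block form with respect to
  \<open>V = S \<union> B\<close>, the matrix \<open>F\<close> solves \<open>M\<^sub>B\<^sub>S + (M\<^sub>B\<^sub>B - \<lambda>) F = 0\<close> and the reduction has
  adjacency matrix \<open>R = M\<^sub>S\<^sub>S + M\<^sub>S\<^sub>B F\<close>. Hence \<open>det (M - \<lambda>)\<close> is the product of
  \<open>det (R - \<lambda>)\<close> and \<open>det (M\<^sub>B\<^sub>B - \<lambda>)\<close>. As \<open>B\<close> has no cycles but loops, the second factor
  is triangular for a suitable enumeration, hence the product of the \<open>\<omega>(b, b) - \<lambda>\<close>, and these have
  neither zeros nor poles off the exceptional set.
\<close>

section \<open>Determinants\<close>

text \<open>Block column elimination: the right factor \<open>?E\<close> has determinant 1 and turns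
  the lower left block into \<open>C + D * F\<close>, which vanishes. For invertible
  \<open>D\<close>, the block \<open>A + B * F\<close> is the Schur complement of
  \<open>D\<close>.\<close>

lemma det_four_block_mat_eliminate:
  fixes A :: "'a :: idom mat"
  assumes A: "A \<in> carrier_mat n n" and B: "B \<in> carrier_mat n m"
    and C: "C \<in> carrier_mat m n" and D: "D \<in> carrier_mat m m"
    and F: "F \<in> carrier_mat m n" and CDF: "C + D * F = 0\<^sub>m m n"
  shows "det (four_block_mat A B C D) = det (A + B * F) * det D"
proof -
  let ?E = "four_block_mat (1\<^sub>m n) (0\<^sub>m n m) F (1\<^sub>m m)"
  have E: "det ?E = 1"
    using F by (subst det_four_block_mat_upper_right_zero[of _ n _ m]) auto
  have "four_block_mat A B C D * ?E =
      four_block_mat (A * 1\<^sub>m n + B * F) (A * 0\<^sub>m n m + B * 1\<^sub>m m)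
        (C * 1\<^sub>m n + D * F) (C * 0\<^sub>m n m + D * 1\<^sub>m m)"
    using A B C D F by (intro mult_four_block_mat) auto
  also have "\<dots> = four_block_mat (A + B * F) B (0\<^sub>m m n) D"
    using A B C D F CDF by simp
  finally have "det (four_block_mat A B C D * ?E) = det (A + B * F) * det D"
    using A B D F by (simp add: det_four_block_mat_lower_left_zero[of _ n _ m])
  moreover have "det (four_block_mat A B C D * ?E) = det (four_block_mat A B C D) * det ?E"
    using A D by (intro det_mult[of _ "n + m"]) auto
  ultimately show ?thesis using E by simp
qed

section \<open>Multiplicities of zeros of rational functions\<close>

text \<open>By construction, \<open>spectrum G z\<close> is
  \<open>zero_order z (char_det G)\<close>.\<close>

definition zero_order :: "complex \<Rightarrow> ratfun \<Rightarrow> enat" where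
  "zero_order z r = (if r = 0 then \<infinity> else enat (order z (fst (quot_of_fract r))))"

text \<open>These are the units of the local ring of rational functions defined at \<open>z\<close>.
  The fraction need not be in lowest terms, which makes closure under products immediate.\<close>

definition ratfun_unit_at :: "complex \<Rightarrow> ratfun \<Rightarrow> bool" where
  "ratfun_unit_at z r \<longleftrightarrow>
     (\<exists>a b. poly a z \<noteq> 0 \<and> poly b z \<noteq> 0 \<and> r = to_fract a / to_fract b)"

lemma ratfun_unit_at_1: "ratfun_unit_at z 1"
  unfolding ratfun_unit_at_def by (intro exI[of _ 1]) auto

lemma ratfun_unit_at_mult:
  assumes "ratfun_unit_at z r" "ratfun_unit_at z s"
  shows "ratfun_unit_at z (r * s)"
proof -
  obtain a b c d where "poly a z \<noteq> 0" "poly b z \<noteq> 0" "r = to_fract a / to_fract b"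
    "poly c z \<noteq> 0" "poly d z \<noteq> 0" "s = to_fract c / to_fract d"
    using assms unfolding ratfun_unit_at_def by blast
  then show ?thesis
    unfolding ratfun_unit_at_def by (intro exI[of _ "a * c"] exI[of _ "b * d"]) simp
qed

lemma ratfun_unit_at_prod_list:
  assumes "\<And>r. r \<in> set rs \<Longrightarrow> ratfun_unit_at z r"
  shows "ratfun_unit_at z (prod_list rs)"
  using assms by (induct rs) (auto intro: ratfun_unit_at_1 ratfun_unit_at_mult)

lemma quot_of_fract_conv_to_fract:
  "r = to_fract (fst (quot_of_fract r)) / to_fract (snd (quot_of_fract r))"
  by (simp flip: Fract_conv_to_fract)

lemma order_quot_of_fract_coprime:
  assumes "r \<noteq> (0 :: ratfun)"
  shows "order z (fst (quot_of_fract r)) = 0 \<or> order z (snd (quot_of_fract r)) = 0"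
proof (rule ccontr)
  assume "\<not> ?thesis"
  then have "poly (fst (quot_of_fract r)) z = 0" "poly (snd (quot_of_fract r)) z = 0"
    by (metis order_root)+
  then show False
    using coprime_quot_of_fract[of r] coprime_poly_0 by blast
qed

text \<open>A unit at \<open>z\<close> preserves the difference between the orders of numerator and
  denominator. In lowest terms one of the two orders is 0, so the difference determines the order of
  the numerator.\<close>

lemma zero_order_mult_unit:
  assumes "ratfun_unit_at z s"
  shows "zero_order z (r * s) = zero_order z r"
proof (cases "r = 0")
  case r: False
  obtain a b where a: "poly a z \<noteq> 0" and b: "poly b z \<noteq> 0" and s: "s = to_fract a / to_fract b"
    using assms unfolding ratfun_unit_at_def by blast
  have ab: "a \<noteq> 0" "b \<noteq> 0" using a b by auto
  let ?p = "fst (quot_of_fract r)" and ?q = "snd (quot_of_fract r)"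
  let ?u = "fst (quot_of_fract (r * s))" and ?v = "snd (quot_of_fract (r * s))"
  have rs: "r * s \<noteq> 0" using r s ab by simp
  have nz: "?p \<noteq> 0" "?q \<noteq> 0" "?u \<noteq> 0" "?v \<noteq> 0" using r rs by simp_all
  have "to_fract ?u / to_fract ?v = to_fract ?p / to_fract ?q * (to_fract a / to_fract b)"
    using quot_of_fract_conv_to_fract[of r] quot_of_fract_conv_to_fract[of "r * s"] s by metis
  then have "to_fract (?u * (?q * b)) = to_fract (?v * (?p * a))"
    using nz ab by (simp add: frac_eq_eq mult_ac)
  then have "?u * (?q * b) = ?v * (?p * a)" by (simp only: to_fract_eq_iff)
  then have "order z (?u * (?q * b)) = order z (?v * (?p * a))" by simp
  then have "order z ?u + order z ?q = order z ?v + order z ?p"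
    using nz ab order_0I[OF a] order_0I[OF b] by (simp add: order_mult)
  then have "order z ?u = order z ?p"
    using order_quot_of_fract_coprime[OF r, of z] order_quot_of_fract_coprime[OF rs, of z] by auto
  then show ?thesis using r rs by (simp add: zero_order_def)
qed (simp add: zero_order_def)

lemma ratfun_unit_at_minus_ratvar:
  assumes "ratfun_defined_at r z" "ratfun_eval r z \<noteq> z"
  shows "ratfun_unit_at z (r - ratvar)"
proof -
  let ?p = "fst (quot_of_fract r)" and ?q = "snd (quot_of_fract r)"
  have q: "poly ?q z \<noteq> 0" using assms(1) by (simp add: ratfun_defined_at_def)
  have "poly (?p - [:0, 1:] * ?q) z \<noteq> 0"
    using assms(2) q by (simp add: ratfun_eval_def field_simps)
  moreover have "r - ratvar = to_fract (?p - [:0, 1:] * ?q) / to_fract ?q"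
  proof -
    have "r - ratvar = to_fract ?p / to_fract ?q - ratvar"
      using quot_of_fract_conv_to_fract[of r] by simp
    also have "\<dots> = to_fract (?p - [:0, 1:] * ?q) / to_fract ?q"
      unfolding to_fract_diff to_fract_mult by (simp add: diff_divide_distrib)
    finally show ?thesis .
  qed
  ultimately show ?thesis using q unfolding ratfun_unit_at_def by blast
qed

section \<open>Branches and the block decomposition\<close>

locale structural_set = weighted_digraph G for G :: "'a wdigraph" +
  fixes S :: "'a set"
  assumes structural: "S \<in> structural_sets G"
begin

abbreviation "w \<equiv> weight G"

definition B where "B = vertices G - S"

lemma S_subset: "S \<subseteq> vertices G"
  and weight_loop_neq: "b \<in> B \<Longrightarrow> w (b, b) \<noteq> ratvar"
  using structural by (auto simp: structural_sets_def B_def)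

lemma finite_B: "finite B" and finite_S: "finite S"
  using pair_finite_verts S_subset by (auto simp: B_def intro: finite_subset)

section \<open>Acyclicity, rank and paths outside \<open>S\<close>\<close>

definition B_edges :: "'a rel" where
  "B_edges = {(u, v) \<in> edges G. u \<in> B \<and> v \<in> B \<and> u \<noteq> v}"

text \<open>A nonempty closed walk contains a cycle, which a structural set forbids outside
  \<open>S\<close> once loops are removed.\<close>

lemma acyclic_B_edges: "acyclic B_edges"
proof (rule acyclicI, rule allI, rule notI)
  fix x assume x: "(x, x) \<in> B_edges\<^sup>+"
  let ?H = "induce_subgraph (with_proj (remove_loops (graph G))) (vertices G - S)"
  interpret H: wf_digraph ?H
    by unfold_locales (auto simp: induce_subgraph_def)
  have "arcs_ends ?H = B_edges"
    by (auto simp: arcs_ends_def arc_to_ends_def induce_subgraph_def remove_loops_def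
        B_edges_def B_def)
  with x have "x \<rightarrow>\<^sup>+\<^bsub>?H\<^esub> x" by simp
  then have "\<exists>p. H.cycle p"
    using H.closed_w_imp_cycle unfolding H.reachable1_awalk H.closed_w_def by blast
  then show False using structural by (auto simp: structural_sets_def)
qed

definition rank :: "'a \<Rightarrow> nat" where
  "rank u = card {v. (u, v) \<in> B_edges\<^sup>+}"

text \<open>Whatever is reachable from \<open>v\<close> is reachable from \<open>u\<close>. The
  inclusion is strict: \<open>v\<close> is reachable from \<open>u\<close> but, by acyclicity, not
  from itself.\<close>

lemma rank_less:
  assumes "(u, v) \<in> B_edges"
  shows "rank v < rank u"
  unfolding rank_def
proof (rule psubset_card_mono)
  have "{x. (u, x) \<in> B_edges\<^sup>+} \<subseteq> B"
    by (auto simp: B_edges_def elim: tranclE)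
  then show "finite {x. (u, x) \<in> B_edges\<^sup>+}" using finite_B finite_subset by blast
  have "v \<in> {x. (u, x) \<in> B_edges\<^sup>+}" "v \<notin> {x. (v, x) \<in> B_edges\<^sup>+}"
    using assms acyclic_B_edges by (auto simp: acyclic_def)
  moreover have "{x. (v, x) \<in> B_edges\<^sup>+} \<subseteq> {x. (u, x) \<in> B_edges\<^sup>+}"
    using assms by (auto intro: trancl_into_trancl2)
  ultimately show "{x. (v, x) \<in> B_edges\<^sup>+} \<subset> {x. (u, x) \<in> B_edges\<^sup>+}" by blast
qed

text \<open>Only the tails of edges are confined to \<open>B\<close>, so the end \<open>j\<close>
  may lie in \<open>S\<close>, and for a vertex \<open>u = j\<close> the empty path is included. A
  direct edge into \<open>j\<close> is thus treated like any other first edge.\<close>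

definition B_paths :: "'a \<Rightarrow> 'a \<Rightarrow> ('a \<times> 'a) list set" where
  "B_paths u j = {p. apath u p j \<and> fst ` set p \<subseteq> B}"

definition path_weight :: "('a \<times> 'a) list \<Rightarrow> ratfun" where
  "path_weight p = (\<Prod>e\<leftarrow>p. w e / (ratvar - w (fst e, fst e)))"

definition F :: "'a \<Rightarrow> 'a \<Rightarrow> ratfun" where
  "F u j = (\<Sum>p\<in>B_paths u j. path_weight p)"

lemma finite_B_paths: "finite (B_paths u j)"
  by (rule finite_subset[OF _ apaths_finite[of u j]]) (auto simp: B_paths_def)

lemma pawalk_verts_eq: "pcas u p v \<Longrightarrow> pawalk_verts u p = map fst p @ [v]"
  by (induct p arbitrary: u) auto

lemma pawalk_verts_B_paths:
  "p \<in> B_paths u j \<Longrightarrow> pawalk_verts u p = map fst p @ [j]"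
  by (auto simp: B_paths_def apath_def awalk_def pawalk_verts_eq)

lemma B_paths_refl: "u \<in> vertices G \<Longrightarrow> B_paths u u = {[]}"
  by (auto simp: B_paths_def apath_def awalk_def pawalk_verts_eq elim: pcas.elims)

text \<open>All vertices but the last lie in \<open>B\<close> and are distinct, so the edges between
  them belong to \<open>B_edges\<close> and the rank falls along the path.\<close>

lemma B_paths_rank_le:
  assumes "p \<in> B_paths c j" "j \<in> S" "v \<in> fst ` set p"
  shows "rank v \<le> rank c"
  using assms
proof (induct p arbitrary: c)
  case (Cons e p)
  then have e: "e \<in> edges G" "fst e = c" "c \<in> B" "apath (snd e) p j" "fst ` set p \<subseteq> B"
    "c \<notin> set (pawalk_verts (snd e) p)"
    by (auto simp: B_paths_def apath_Cons_iff)
  show ?case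
  proof (cases "v \<in> fst ` set p")
    case True
    then have ve: "rank v \<le> rank (snd e)"
      using Cons e by (auto simp: B_paths_def)
    have "snd e \<in> B"
      using True e by (cases p) (auto simp: apath_Cons_iff)
    moreover have "snd e \<noteq> c" using e by (cases p) (auto simp: apath_Cons_iff)
    ultimately have "(c, snd e) \<in> B_edges"
      using e by (cases e) (auto simp: B_edges_def)
    then show ?thesis using ve rank_less by fastforce
  next
    case False
    then show ?thesis using Cons e by auto
  qed
qed simp

section \<open>Splitting off the first edge\<close>

text \<open>A loop at \<open>b\<close> cannot start a path; its weight enters only through the
  denominators in \<open>path_weight\<close>.\<close>

lemma B_paths_step:
  assumes b: "b \<in> B" and j: "j \<in> S"
  shows "B_paths b j =
    (\<Union>c \<in> {c \<in> insert j (B - {b}). (b, c) \<in> edges G}. (#) (b, c) ` B_paths c j)"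
proof (intro equalityI subsetI)
  fix p assume p: "p \<in> B_paths b j"
  have "b \<noteq> j" using b j by (auto simp: B_def)
  then obtain e q where pe: "p = e # q"
    using p by (cases p) (auto simp: B_paths_def apath_def awalk_def)
  then have e: "e \<in> edges G" "fst e = b" "apath (snd e) q j" "fst ` set q \<subseteq> B"
    "b \<notin> set (pawalk_verts (snd e) q)"
    using p by (auto simp: B_paths_def apath_Cons_iff)
  have "snd e = j \<or> snd e \<in> B"
    using e by (cases q) (auto simp: apath_def awalk_def)
  moreover have "snd e \<noteq> b" using e by (cases q) (auto simp: apath_Cons_iff)
  moreover have "e = (b, snd e)" using e by (cases e) auto
  ultimately show "p \<in> (\<Union>c \<in> {c \<in> insert j (B - {b}). (b, c) \<in> edges G}. (#) (b, c) ` B_paths c j)"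
    using e pe by (auto simp: B_paths_def intro!: bexI[of _ "snd e"])
next
  fix p assume "p \<in> (\<Union>c \<in> {c \<in> insert j (B - {b}). (b, c) \<in> edges G}. (#) (b, c) ` B_paths c j)"
  then obtain c q where c: "c = j \<or> c \<in> B" "c = j \<or> c \<noteq> b" "(b, c) \<in> edges G"
    and q: "q \<in> B_paths c j" and p: "p = (b, c) # q"
    by auto
  have "b \<noteq> j" using b j by (auto simp: B_def)
  \<comment> \<open>Acyclicity keeps the extended path simple: a return to \<open>b\<close> would
    give \<open>rank b \<le> rank c < rank b\<close>. Here \<open>c = j\<close> is impossible, since
    the only path from \<open>j\<close> to itself is empty.\<close>
  have "b \<notin> fst ` set q"
  proof
    assume bq: "b \<in> fst ` set q"
    then have "q \<noteq> []" by auto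
    moreover have "c \<in> vertices G" using c in_arcsD2 by blast
    ultimately have "c \<noteq> j" using q B_paths_refl by auto
    then have "(b, c) \<in> B_edges" using b c by (auto simp: B_edges_def)
    then show False using rank_less B_paths_rank_le[OF q j bq] by fastforce
  qed
  then have "b \<notin> set (pawalk_verts c q)"
    using \<open>b \<noteq> j\<close> by (simp add: pawalk_verts_B_paths[OF q])
  then show "p \<in> B_paths b j"
    using q c b p by (auto simp: B_paths_def apath_Cons_iff)
qed

text \<open>As \<open>i\<close> lies in \<open>S\<close>, it can recur on a path running through
  \<open>B\<close> only as the end \<open>j\<close>: prefixing the edge yields a cycle if
  \<open>i = j\<close> and a path otherwise.\<close>

lemma branches_step:
  assumes i: "i \<in> S" and j: "j \<in> S"
  shows "branches G S i j =
    (\<Union>c \<in> {c \<in> insert j B. (i, c) \<in> edges G}. (#) (i, c) ` B_paths c j)"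
proof (intro equalityI subsetI)
  fix p assume p: "p \<in> branches G S i j"
  then obtain e q where pe: "p = e # q" by (cases p) (auto simp: branches_def)
  have "awalk i p j" using p by (auto simp: branches_def apath_def)
  then have e: "e \<in> edges G" "fst e = i" "awalk (snd e) q j"
    by (auto simp: pe awalk_Cons_iff)
  \<comment> \<open>In paths and cycles alike the vertices after the first are distinct, so removing
    the first edge leaves a path in both cases.\<close>
  have "distinct (tl (pawalk_verts i p))"
    using p by (auto simp: pe branches_def apath_def cycle_def)
  then have q: "apath (snd e) q j" using e by (simp add: pe apath_def)
  have "fst ` set q \<inter> S = {}" using p e pe
    by (auto simp: branches_def inner_verts_def)
  moreover have "fst ` set q \<subseteq> vertices G"
    using e in_arcsD1 by (force simp: awalk_def)
  ultimately have qB: "fst ` set q \<subseteq> B" by (auto simp: B_def)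
  have "snd e = j \<or> snd e \<in> B"
    using e qB by (cases q) (auto simp: awalk_def)
  moreover have "e = (i, snd e)" using e by (cases e) auto
  ultimately show "p \<in> (\<Union>c \<in> {c \<in> insert j B. (i, c) \<in> edges G}. (#) (i, c) ` B_paths c j)"
    using e pe q qB by (auto simp: B_paths_def intro!: bexI[of _ "snd e"])
next
  fix p assume "p \<in> (\<Union>c \<in> {c \<in> insert j B. (i, c) \<in> edges G}. (#) (i, c) ` B_paths c j)"
  then obtain c q where c: "(i, c) \<in> edges G" and q: "q \<in> B_paths c j" and p: "p = (i, c) # q"
    by auto
  have qB: "fst ` set q \<subseteq> B" and qa: "apath c q j" using q by (auto simp: B_paths_def)
  have aw: "awalk i p j" using qa c by (simp add: p awalk_Cons_iff apath_def)
  have "cycle p" if "i = j"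
    using aw qa that by (auto simp: cycle_def apath_def p)
  moreover have "apath i p j" if "i \<noteq> j"
  proof -
    have "i \<notin> set (pawalk_verts c q)"
      using qB i that by (auto simp: pawalk_verts_B_paths[OF q] B_def)
    then show ?thesis using qa c by (simp add: p apath_Cons_iff)
  qed
  moreover have "set (inner_verts p) \<inter> S = {}"
    using qB by (auto simp: inner_verts_def p B_def)
  ultimately show "p \<in> branches G S i j"
    using aw by (auto simp: branches_def p)
qed

section \<open>Linear equations for the path sums\<close>

text \<open>The factor \<open>x\<close> serves both decompositions: it is the inverse of
  \<open>ratvar - w (u, u)\<close> for paths from \<open>B\<close>, and 1 for branches, whose first
  edge carries no denominator.\<close>

lemma sum_edge_Cons:
  fixes g :: "'a \<Rightarrow> ratfun"
  assumes "finite A"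
    and "\<And>c p. c \<in> A \<Longrightarrow> p \<in> B_paths c j \<Longrightarrow> h ((u, c) # p) = w (u, c) * x * path_weight p"
  shows "sum h (\<Union>c \<in> {c \<in> A. (u, c) \<in> edges G}. (#) (u, c) ` B_paths c j) =
    (\<Sum>c\<in>A. w (u, c) * x * F c j)"
proof -
  have "sum h (\<Union>c \<in> {c \<in> A. (u, c) \<in> edges G}. (#) (u, c) ` B_paths c j) =
      (\<Sum>c \<in> {c \<in> A. (u, c) \<in> edges G}. sum h ((#) (u, c) ` B_paths c j))"
    using assms(1) finite_B_paths by (intro sum.UNION_disjoint) auto
  also have "\<dots> = (\<Sum>c \<in> {c \<in> A. (u, c) \<in> edges G}. w (u, c) * x * F c j)"
    using assms(2) by (intro sum.cong refl) (simp add: sum.reindex F_def sum_distrib_left)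
  \<comment> \<open>Pairs that are not edges have weight 0.\<close>
  also have "\<dots> = (\<Sum>c\<in>A. w (u, c) * x * F c j)"
    using assms(1) by (intro sum.mono_neutral_left) (auto simp: weight_eq_0_iff)
  finally show ?thesis .
qed

lemma F_refl: "j \<in> S \<Longrightarrow> F j j = 1"
  using S_subset by (auto simp: F_def B_paths_refl path_weight_def)

text \<open>Clear the denominator \<open>ratvar - w (b, b)\<close> in the first-edge recurrence; the
  loop term, moved to the other side, completes the sum over \<open>B - {b}\<close> to one over
  \<open>B\<close>.\<close>

lemma F_step:
  assumes b: "b \<in> B" and j: "j \<in> S"
  shows "w (b, j) + (\<Sum>c\<in>B. w (b, c) * F c j) = ratvar * F b j"
proof -
  have jB: "j \<notin> B" using j by (auto simp: B_def)
  define x where "x = ratvar - w (b, b)"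
  have x0: "x \<noteq> 0" using weight_loop_neq[OF b] by (simp add: x_def)
  have "F b j = (\<Sum>c\<in>insert j (B - {b}). w (b, c) * (1 / x) * F c j)"
    unfolding F_def[of b j] B_paths_step[OF b j]
    using finite_B by (intro sum_edge_Cons) (auto simp: path_weight_def x_def)
  also have "\<dots> = (\<Sum>c\<in>insert j (B - {b}). w (b, c) * F c j) / x"
    by (simp add: sum_divide_distrib)
  also have "(\<Sum>c\<in>insert j (B - {b}). w (b, c) * F c j) =
      w (b, j) + (\<Sum>c\<in>B - {b}. w (b, c) * F c j)"
    using finite_B jB j by (simp add: F_refl)
  finally have "x * F b j = w (b, j) + (\<Sum>c\<in>B - {b}. w (b, c) * F c j)"
    using x0 by (simp add: field_simps)
  then show ?thesis
    using finite_B b by (simp add: sum.remove x_def algebra_simps)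
qed

lemma weight_reduction:
  assumes i: "i \<in> S" and j: "j \<in> S"
  shows "weight (isospectral_reduction G S) (i, j) = w (i, j) + (\<Sum>c\<in>B. w (i, c) * F c j)"
proof -
  have jB: "j \<notin> B" using j by (auto simp: B_def)
  \<comment> \<open>Without branches, the default weight 0 agrees with the empty sum.\<close>
  have "weight (isospectral_reduction G S) (i, j) = (\<Sum>p\<in>branches G S i j. branch_product G p)"
    using i j by (auto simp: isospectral_reduction_def)
  also have "\<dots> = (\<Sum>c\<in>insert j B. w (i, c) * 1 * F c j)"
    unfolding branches_step[OF i j] using finite_B
    by (intro sum_edge_Cons) (auto simp: branch_product_def path_weight_def)
  finally show ?thesis using finite_B jB j by (simp add: F_refl)
qed

section \<open>Factorization of the characteristic determinant\<close>

lemma char_det_enum_append: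
  assumes ss: "distinct ss" "set ss = S" and bs: "distinct bs" "set bs = B"
  shows "char_det_enum G (ss @ bs) =
    char_det_enum (isospectral_reduction G S) ss * char_det_enum G bs"
proof -
  let ?n = "length ss" and ?m = "length bs" and ?R = "isospectral_reduction G S"
  define A where "A = adj_mat G ss - ratvar \<cdot>\<^sub>m 1\<^sub>m ?n"
  define B' where "B' = mat ?n ?m (\<lambda>(i, j). w (ss ! i, bs ! j))"
  define C where "C = mat ?m ?n (\<lambda>(i, j). w (bs ! i, ss ! j))"
  define D where "D = adj_mat G bs - ratvar \<cdot>\<^sub>m 1\<^sub>m ?m"
  define F' where "F' = mat ?m ?n (\<lambda>(i, j). F (bs ! i) (ss ! j))"
  have ssS: "ss ! i \<in> S" if "i < ?n" for i using nth_mem[OF that] ss(2) by simp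
  have bsB: "bs ! i \<in> B" if "i < ?m" for i using nth_mem[OF that] bs(2) by simp
  have sum_bs: "(\<Sum>k<?m. g (bs ! k)) = (\<Sum>c\<in>B. g c)" for g :: "'a \<Rightarrow> ratfun"
    using bs by (intro sum.reindex_bij_betw bij_betw_nth) auto
  have carrier: "A \<in> carrier_mat ?n ?n" "B' \<in> carrier_mat ?n ?m" "C \<in> carrier_mat ?m ?n"
    "D \<in> carrier_mat ?m ?m" "F' \<in> carrier_mat ?m ?n"
    by (auto simp: A_def B'_def C_def D_def F'_def adj_mat_def)
  \<comment> \<open>Entrywise this is \<open>F_step\<close>; the right-hand side there comes from
    the diagonal term of \<open>D\<close>.\<close>
  have "C + D * F' = 0\<^sub>m ?m ?n"
  proof (rule eq_matI)
    fix i j assume "i < dim_row (0\<^sub>m ?m ?n)" "j < dim_col (0\<^sub>m ?m ?n)"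
    then have ij: "i < ?m" "j < ?n" by auto
    have "(D * F') $$ (i, j) =
        (\<Sum>k<?m. (w (bs ! i, bs ! k) - (if i = k then ratvar else 0)) * F (bs ! k) (ss ! j))"
      using ij by (auto simp: D_def F'_def adj_mat_def scalar_prod_def atLeast0LessThan
          intro!: sum.cong)
    also have "\<dots> = (\<Sum>k<?m. w (bs ! i, bs ! k) * F (bs ! k) (ss ! j)) -
        (\<Sum>k<?m. if i = k then ratvar * F (bs ! k) (ss ! j) else 0)"
      unfolding sum_subtractf[symmetric] by (intro sum.cong) (auto simp: left_diff_distrib)
    also have "\<dots> = (\<Sum>c\<in>B. w (bs ! i, c) * F c (ss ! j)) - ratvar * F (bs ! i) (ss ! j)"
      unfolding sum_bs[of "\<lambda>c. w (bs ! i, c) * F c (ss ! j)"] using ij by simp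
    finally have DF: "(D * F') $$ (i, j) =
        (\<Sum>c\<in>B. w (bs ! i, c) * F c (ss ! j)) - ratvar * F (bs ! i) (ss ! j)" .
    have "(C + D * F') $$ (i, j) = w (bs ! i, ss ! j) + (D * F') $$ (i, j)"
      using ij carrier by (simp add: C_def)
    also have "\<dots> = 0"
      unfolding DF F_step[OF bsB ssS, OF ij, symmetric] by simp
    finally show "(C + D * F') $$ (i, j) = 0\<^sub>m ?m ?n $$ (i, j)" using ij by simp
  qed (use carrier in auto)
  moreover have "A + B' * F' = adj_mat ?R ss - ratvar \<cdot>\<^sub>m 1\<^sub>m ?n"
  proof (rule eq_matI)
    fix i j assume "i < dim_row (adj_mat ?R ss - ratvar \<cdot>\<^sub>m 1\<^sub>m ?n)"
      "j < dim_col (adj_mat ?R ss - ratvar \<cdot>\<^sub>m 1\<^sub>m ?n)"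
    then have ij: "i < ?n" "j < ?n" by auto
    have "(B' * F') $$ (i, j) = (\<Sum>k<?m. w (ss ! i, bs ! k) * F (bs ! k) (ss ! j))"
      using ij by (auto simp: B'_def F'_def scalar_prod_def atLeast0LessThan intro!: sum.cong)
    then have "(B' * F') $$ (i, j) = (\<Sum>c\<in>B. w (ss ! i, c) * F c (ss ! j))"
      unfolding sum_bs[of "\<lambda>c. w (ss ! i, c) * F c (ss ! j)"] .
    then show "(A + B' * F') $$ (i, j) = (adj_mat ?R ss - ratvar \<cdot>\<^sub>m 1\<^sub>m ?n) $$ (i, j)"
      using ij carrier weight_reduction[OF ssS ssS, OF ij] by (simp add: A_def adj_mat_def)
  qed (use carrier in \<open>auto simp: adj_mat_def\<close>)
  moreover have "adj_mat G (ss @ bs) - ratvar \<cdot>\<^sub>m 1\<^sub>m (length (ss @ bs)) = four_block_mat A B' C D"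
    by (rule eq_matI) (auto simp: A_def B'_def C_def D_def adj_mat_def nth_append)
  ultimately show ?thesis
    using det_four_block_mat_eliminate[OF carrier] by (simp add: char_det_enum_def D_def)
qed

lemma char_det_enum_B:
  obtains bs where "distinct bs" "set bs = B"
    "char_det_enum G bs = (\<Prod>b\<leftarrow>bs. w (b, b) - ratvar)"
proof -
  obtain bs0 where bs0: "distinct bs0" "set bs0 = B"
    using finite_distinct_list[OF finite_B] by blast
  \<comment> \<open>Edges of \<open>B_edges\<close> strictly lower the rank, so with increasing rank
    all entries above the diagonal vanish.\<close>
  define bs where "bs = sort_key rank bs0"
  have bs: "distinct bs" "set bs = B" "sorted (map rank bs)"
    using bs0 by (simp_all add: bs_def)
  let ?n = "length bs"
  let ?D = "adj_mat G bs - ratvar \<cdot>\<^sub>m 1\<^sub>m ?n"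
  have "det ?D = prod_list (diag_mat ?D)"
  proof (rule det_lower_triangular)
    fix i j assume ij: "i < j" "j < ?n"
    then have "rank (bs ! i) \<le> rank (bs ! j)"
      using sorted_nth_mono[OF bs(3), of i j] by simp
    then have "(bs ! i, bs ! j) \<notin> B_edges" using rank_less by fastforce
    moreover have "bs ! i \<in> B" "bs ! j \<in> B" "bs ! i \<noteq> bs ! j"
      using ij bs nth_mem[of i bs] nth_mem[of j bs] by (auto simp: nth_eq_iff_index_eq)
    ultimately show "?D $$ (i, j) = 0"
      using ij by (simp add: adj_mat_def weight_eq_0_iff B_edges_def)
  qed (auto simp: adj_mat_def)
  moreover have "diag_mat ?D = map (\<lambda>b. w (b, b) - ratvar) bs"
    by (rule nth_equalityI) (auto simp: diag_mat_def adj_mat_def)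
  ultimately show ?thesis using that bs by (simp add: char_det_enum_def)
qed

theorem char_det_factorization:
  obtains bs where "set bs = vertices G - S"
    "char_det G = char_det (isospectral_reduction G S) * (\<Prod>b\<leftarrow>bs. w (b, b) - ratvar)"
proof -
  obtain ss where ss: "distinct ss" "set ss = S"
    using finite_distinct_list[OF finite_S] by blast
  obtain bs where bs: "distinct bs" "set bs = B"
    "char_det_enum G bs = (\<Prod>b\<leftarrow>bs. w (b, b) - ratvar)"
    by (rule char_det_enum_B)
  have "char_det G = char_det_enum G (ss @ bs)"
    using ss bs S_subset by (intro char_det_eq) (auto simp: B_def)
  moreover have "char_det (isospectral_reduction G S) =
      char_det_enum (isospectral_reduction G S) ss"
    using ss by (intro char_det_eq) (auto simp: isospectral_reduction_def)
  ultimately show ?thesis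
    using that bs char_det_enum_append[OF ss bs(1,2)] by (simp add: B_def)
qed

end

section \<open>Comparison of the spectra\<close>

theorem theorem1:
  fixes G :: "'a wdigraph" and S :: "'a set"
  assumes "weighted_digraph G"
    and "S \<in> structural_sets G"
  shows "differ_at_most (exceptional_set G S)
           (spectrum G) (spectrum (isospectral_reduction G S))"
proof -
  interpret structural_set G S
    using assms by (simp add: structural_set_def structural_set_axioms_def)
  obtain bs where bs: "set bs = vertices G - S"
    and fact: "char_det G =
      char_det (isospectral_reduction G S) * (\<Prod>b\<leftarrow>bs. weight G (b, b) - ratvar)"
    by (rule char_det_factorization)
  have "spectrum G z = spectrum (isospectral_reduction G S) z"
    if z: "z \<notin> exceptional_set G S" for z
  proof -
    \<comment> \<open>Off the exceptional set each loop weight is defined at \<open>z\<close> with a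
      value other than \<open>z\<close>, so each factor is a unit there.\<close>
    have "ratfun_unit_at z (\<Prod>b\<leftarrow>bs. weight G (b, b) - ratvar)"
      using z bs
      by (intro ratfun_unit_at_prod_list)
        (force simp: exceptional_set_def intro!: ratfun_unit_at_minus_ratvar)
    \<comment> \<open>This includes an identically vanishing determinant, where both multiplicities
      are infinite.\<close>
    from zero_order_mult_unit[OF this, of "char_det (isospectral_reduction G S)"]
    show ?thesis
      unfolding fact[symmetric] by (simp add: zero_order_def spectrum_def)
  qed
  then show ?thesis by (simp add: differ_at_most_def list_diff_def fun_eq_iff)
qed

end
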